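(* (1) For all positive integers $m, m_1, m_2$ with $m_1 + m_2 = m$ and all nonnegative integers $k, k_1, k_2$ with $k_1 + k_2 = k-1$, we have $f(m,k) \leq f(m_1,k_1) + f(m_2,k_2)$. (2) Let $m$ be a positive integer and $k$ a nonnegative integer, and suppose $k+1 = am + b$ with integers $a \geq 1$ and $1 \leq b \leq m$. Then $f(m,k) \leq b\,f(a) + (m-b)\,f(a-1)$.
   Context: A tournament is a directed graph obtained by orienting each edge of a complete graph (no loops). In a tournament, a vertex $u$ dominates a set of vertices $U$ (written $u \rightarrow U$) if $(u,w)$ is an edge for every $w \in U$ (in particular $u \notin U$). Let $\tau = \{T_1, \dots, T_m\}$ be a collection of $m$ labeled tournaments, all on the same vertex set $V(\tau)$ (repetitions among the $T_i$ allowed). The collection $\tau$ has Schütte's property $S_k$ if for every $k$-element subset $U \subseteq V(\tau)$ there exist an index $i$ and a vertex $u \in V(\tau)$ with $u \rightarrow U$ in $T_i$. For positive integers $m$ and nonnegative integers $k$, $f(m,k)$ denotes the minimum size of a vertex set $V$ such that there is a collection of $m$ tournaments on $V$ having property $S_k$. For a nonnegative integer $j$, $f(j) = f(1,j)$ is the smallest order of a single tournament with property $S_j$ (so $f(0)=1$). *)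

theory Defs
  imports "Graph_Theory.Pair_Digraph"
begin

definition tournament :: "'a pair_pre_digraph \<Rightarrow> bool" where
  "tournament G \<longleftrightarrow> pair_digraph G \<and> asym (parcs G) \<and> total_on (pverts G) (parcs G)"

definition dominates :: "'a pair_pre_digraph \<Rightarrow> 'a \<Rightarrow> 'a set \<Rightarrow> bool" where
  "dominates G u U \<longleftrightarrow> (\<forall>w\<in>U. (u, w) \<in> parcs G)"

text \<open>A labeled collection is a list, so repetitions are allowed and its length is the number of
  tournaments.\<close>

definition tournament_collection :: "'a set \<Rightarrow> 'a pair_pre_digraph list \<Rightarrow> bool" where
  "tournament_collection V \<tau> \<longleftrightarrow> (\<forall>T\<in>set \<tau>. tournament T \<and> pverts T = V)"

definition schuette_property :: "nat \<Rightarrow> 'a set \<Rightarrow> 'a pair_pre_digraph list \<Rightarrow> bool" where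
  "schuette_property k V \<tau> \<longleftrightarrow>
    (\<forall>U. U \<subseteq> V \<and> finite U \<and> card U = k \<longrightarrow> (\<exists>T\<in>set \<tau>. \<exists>u\<in>V. dominates T u U))"

text \<open>The condition \<open>k \<le> card V\<close> excludes vertex sets without any \<open>k\<close>-element subset, on which
  the property holds vacuously; without it the minimum would be 0 for every \<open>k \<ge> 1\<close>.
  Vertices are natural numbers without loss of generality, since only the size of the finite set
  \<open>V\<close> matters.\<close>

definition schuette_number :: "nat \<Rightarrow> nat \<Rightarrow> nat" where
  "schuette_number m k =
    (LEAST n. \<exists>(V :: nat set) \<tau>. finite V \<and> card V = n \<and> k \<le> card V \<and>
       length \<tau> = m \<and> tournament_collection V \<tau> \<and> schuette_property k V \<tau>)"

abbreviation single_schuette_number :: "nat \<Rightarrow> nat" where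
  "single_schuette_number j \<equiv> schuette_number 1 j"

end

(* The vertex set for part (1) is a disjoint union V1, V2 of optimal sets. The m1 tournaments on V1
   are extended by letting V1 beat all of V2, and the m2 tournaments on V2 by letting V2 beat all of
   V1; a set of k1 + k2 + 1 vertices meets V1 in at most k1 or V2 in at most k2 vertices, so one of
   the two families dominates it. Part (2) iterates (1) with single tournaments.

   The LEAST in the definition of f is meaningful only if some tournament has property S_k. This is
   the theorem of Erdos: among the tournaments on n vertices, those in which a given k-set is
   undominated form at most the fraction (1 - 2^-k)^(n - k), and (n choose k) times this tends to
   0. *)

theory Submission
  imports Defs "HOL-Real_Asymp.Real_Asymp"
begin

section \<open>Tournaments as relations, and relabelling of vertices\<close>

text \<open>The remaining axioms of \<open>pair_digraph\<close> come for free: finitely many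
  vertices leave finitely many arcs, and asymmetry excludes loops.\<close>

lemma tournament_iff:
  "tournament G \<longleftrightarrow> finite (pverts G) \<and> parcs G \<subseteq> pverts G \<times> pverts G \<and>
     asym (parcs G) \<and> total_on (pverts G) (parcs G)"
proof
  assume "tournament G"
  then have T: "pair_digraph G" "asym (parcs G)" "total_on (pverts G) (parcs G)"
    by (auto simp: tournament_def)
  interpret pair_digraph G by fact
  show "finite (pverts G) \<and> parcs G \<subseteq> pverts G \<times> pverts G \<and>
     asym (parcs G) \<and> total_on (pverts G) (parcs G)"
    using T pair_finite_verts in_arcsD1 in_arcsD2 by auto
next
  assume *: "finite (pverts G) \<and> parcs G \<subseteq> pverts G \<times> pverts G \<and>
     asym (parcs G) \<and> total_on (pverts G) (parcs G)"
  then have "finite (parcs G)"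
    by (meson finite_SigmaI finite_subset)
  with * have "pair_digraph G"
    by unfold_locales (auto dest: asymD)
  with * show "tournament G"
    by (auto simp: tournament_def)
qed

text \<open>The vertex type is arbitrary here, unlike in \<open>schuette_number\<close>, so that
  disjoint unions can be formed in a sum type.\<close>

definition schuette_set :: "nat \<Rightarrow> nat \<Rightarrow> 'a set \<Rightarrow> bool" where
  "schuette_set m k V \<longleftrightarrow> finite V \<and> k \<le> card V \<and>
     (\<exists>\<tau>. length \<tau> = m \<and> tournament_collection V \<tau> \<and> schuette_property k V \<tau>)"

lemma schuette_number_eq:
  "schuette_number m k = (LEAST n. \<exists>V :: nat set. card V = n \<and> schuette_set m k V)"
  unfolding schuette_number_def schuette_set_def
  by (rule arg_cong[where f = Least]) auto

definition relabel :: "('a \<Rightarrow> 'b) \<Rightarrow> 'a pair_pre_digraph \<Rightarrow> 'b pair_pre_digraph" where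
  "relabel f G = \<lparr>pverts = f ` pverts G, parcs = map_prod f f ` parcs G\<rparr>"

lemma relabel_simps [simp]:
  "pverts (relabel f G) = f ` pverts G"
  "parcs (relabel f G) = map_prod f f ` parcs G"
  by (simp_all add: relabel_def)

lemma tournament_relabel:
  assumes "tournament G" "inj_on f (pverts G)"
  shows "tournament (relabel f G)"
proof -
  have G: "finite (pverts G)" "parcs G \<subseteq> pverts G \<times> pverts G" "asym (parcs G)"
    "total_on (pverts G) (parcs G)"
    using assms(1) by (auto simp: tournament_iff)
  have "asym (map_prod f f ` parcs G)"
  proof (rule asymI, rule notI)
    fix x y assume "(x, y) \<in> map_prod f f ` parcs G" "(y, x) \<in> map_prod f f ` parcs G"
    then obtain a b c d where *: "(a, b) \<in> parcs G" "(c, d) \<in> parcs G"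
      "x = f a" "y = f b" "y = f c" "x = f d"
      by auto
    then have "a = d" "b = c"
      using G(2) assms(2) by (auto simp: inj_on_def)
    with * show False
      using G(3) by (auto dest: asymD)
  qed
  moreover have "total_on (f ` pverts G) (map_prod f f ` parcs G)"
  proof (rule total_onI)
    fix x y assume "x \<in> f ` pverts G" "y \<in> f ` pverts G" "x \<noteq> y"
    then obtain a b where *: "a \<in> pverts G" "b \<in> pverts G" "x = f a" "y = f b" "a \<noteq> b"
      by auto
    then have "(a, b) \<in> parcs G \<or> (b, a) \<in> parcs G"
      using G(4) by (auto simp: total_on_def)
    then show "(x, y) \<in> map_prod f f ` parcs G \<or> (y, x) \<in> map_prod f f ` parcs G"
      using * by force
  qed
  ultimately show ?thesis
    using G(1,2) by (auto simp: tournament_iff)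
qed

text \<open>A \<open>k\<close>-subset of the image is the image of a \<open>k\<close>-subset
  \<open>W\<close> of \<open>V\<close>, and the image of a vertex dominating \<open>W\<close>
  dominates it.\<close>

lemma schuette_set_image:
  assumes "schuette_set m k V" "inj_on f V"
  shows "schuette_set m k (f ` V)"
proof -
  obtain \<tau> where \<tau>: "finite V" "k \<le> card V" "length \<tau> = m" "tournament_collection V \<tau>"
    "schuette_property k V \<tau>"
    using assms(1) by (auto simp: schuette_set_def)
  have "tournament_collection (f ` V) (map (relabel f) \<tau>)"
    using \<tau>(4) assms(2) by (auto simp: tournament_collection_def intro!: tournament_relabel)
  moreover have "schuette_property k (f ` V) (map (relabel f) \<tau>)"
    unfolding schuette_property_def
  proof safe
    fix U assume U: "U \<subseteq> f ` V" "finite U" "k = card U"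
    then obtain W where W: "W \<subseteq> V" "U = f ` W"
      by (auto simp: subset_image_iff)
    then have "card W = card U" "finite W"
      using assms(2) \<tau>(1) by (auto intro!: card_image[symmetric] intro: inj_on_subset finite_subset)
    then obtain T u where "T \<in> set \<tau>" "u \<in> V" "dominates T u W"
      using \<tau>(5) W U by (metis schuette_property_def)
    then have "dominates (relabel f T) (f u) U"
      using W by (force simp: dominates_def)
    then show "\<exists>T\<in>set (map (relabel f) \<tau>). \<exists>u\<in>f ` V. dominates T u U"
      using \<open>T \<in> set \<tau>\<close> \<open>u \<in> V\<close> by auto
  qed
  moreover have "card (f ` V) = card V"
    using assms(2) by (rule card_image)
  ultimately show ?thesis
    using \<tau>(1,2,3) unfolding schuette_set_def by (metis finite_imageI length_map)
qed

text \<open>A finite set of any type injects into the naturals, so a collection on it competes in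
  the minimum.\<close>

lemma schuette_number_le:
  assumes "schuette_set m k V"
  shows "schuette_number m k \<le> card V"
proof -
  have "finite V"
    using assms by (simp add: schuette_set_def)
  then obtain f :: "'a \<Rightarrow> nat" where f: "inj_on f V"
    by (metis finite_imp_inj_to_nat_seg)
  then have "schuette_set m k (f ` V)" "card (f ` V) = card V"
    using assms by (auto intro: schuette_set_image card_image)
  then show ?thesis
    unfolding schuette_number_eq by (intro Least_le) blast
qed

section \<open>Smaller sets and a bound on the order\<close>

text \<open>Since \<open>k \<le> card V\<close>, the set \<open>U\<close> extends to a
  \<open>k\<close>-subset of \<open>V\<close>; what dominates the larger set dominates
  \<open>U\<close>.\<close>

lemma schuette_property_antimono:
  assumes "schuette_property k V \<tau>" "finite V" "k \<le> card V" "U \<subseteq> V" "card U \<le> k"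
  shows "\<exists>T\<in>set \<tau>. \<exists>u\<in>V. dominates T u U"
proof -
  obtain W where W: "U \<subseteq> W" "W \<subseteq> V" "card W = k"
    using assms exists_subset_between[of U k V] by metis
  then obtain T u where "T \<in> set \<tau>" "u \<in> V" "dominates T u W"
    using assms(1,2) by (metis schuette_property_def finite_subset)
  then show ?thesis
    using W(1) by (auto simp: dominates_def)
qed

text \<open>If \<open>card V = k\<close>, then \<open>V\<close> itself must be dominated by one of
  its own vertices, which gives a loop.\<close>

lemma schuette_set_card_gt:
  assumes "schuette_set m k V"
  shows "k < card V"
proof (rule ccontr)
  assume "\<not> k < card V"
  with assms obtain \<tau> where \<tau>: "finite V" "k = card V" "tournament_collection V \<tau>"
    "schuette_property k V \<tau>"
    by (force simp: schuette_set_def)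
  then obtain T u where T: "T \<in> set \<tau>" "u \<in> V" "dominates T u V"
    by (auto simp: schuette_property_def)
  then have "(u, u) \<in> parcs T"
    by (auto simp: dominates_def)
  moreover have "asym (parcs T)"
    using T(1) \<tau>(3) by (auto simp: tournament_collection_def tournament_def)
  ultimately show False
    by (auto dest: asymD)
qed

section \<open>Joining two collections\<close>

definition ordered_join :: "'a pair_pre_digraph \<Rightarrow> 'a pair_pre_digraph \<Rightarrow> 'a pair_pre_digraph" where
  "ordered_join G H = \<lparr>pverts = pverts G \<union> pverts H,
     parcs = parcs G \<union> parcs H \<union> pverts G \<times> pverts H\<rparr>"

lemma ordered_join_simps [simp]:
  "pverts (ordered_join G H) = pverts G \<union> pverts H"
  "parcs (ordered_join G H) = parcs G \<union> parcs H \<union> pverts G \<times> pverts H"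
  by (simp_all add: ordered_join_def)

lemma tournament_ordered_join:
  assumes "tournament G" "tournament H" "pverts G \<inter> pverts H = {}"
  shows "tournament (ordered_join G H)"
proof -
  have G: "finite (pverts G)" "parcs G \<subseteq> pverts G \<times> pverts G" "asym (parcs G)"
    "total_on (pverts G) (parcs G)"
    and H: "finite (pverts H)" "parcs H \<subseteq> pverts H \<times> pverts H" "asym (parcs H)"
    "total_on (pverts H) (parcs H)"
    using assms(1,2) by (auto simp: tournament_iff)
  have "asym (parcs (ordered_join G H))"
    by (rule asymI) (use G(2,3) H(2,3) assms(3) in \<open>auto dest: asymD\<close>)
  moreover have "total_on (pverts (ordered_join G H)) (parcs (ordered_join G H))"
    using G(4) H(4) by (auto simp: total_on_def)
  ultimately show ?thesis
    using G(1,2) H(1,2) by (auto simp: tournament_iff)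
qed

text \<open>In the join every vertex of \<open>V\<close> already beats all of \<open>H\<close>, so a
  vertex of \<open>V\<close> that dominates \<open>U \<inter> V\<close> dominates all of
  \<open>U\<close>.\<close>

lemma ordered_join_dominates:
  assumes "schuette_property k V \<tau>" "finite V" "k \<le> card V" "tournament_collection V \<tau>"
    and "U \<subseteq> V \<union> pverts H" "card (U \<inter> V) \<le> k"
  shows "\<exists>T\<in>(\<lambda>G. ordered_join G H) ` set \<tau>. \<exists>u\<in>V. dominates T u U"
proof -
  obtain T u where T: "T \<in> set \<tau>" "u \<in> V" "dominates T u (U \<inter> V)"
    using schuette_property_antimono[OF assms(1-3) _ assms(6)] by auto
  then have "pverts T = V"
    using assms(4) by (auto simp: tournament_collection_def)
  then have "dominates (ordered_join T H) u U"
    using T assms(5) by (auto simp: dominates_def)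
  with T show ?thesis
    by auto
qed

lemma schuette_set_Un:
  assumes 1: "schuette_set m1 k1 V1" and 2: "schuette_set m2 k2 V2"
    and pos: "m1 > 0" "m2 > 0" and disj: "V1 \<inter> V2 = {}"
  shows "schuette_set (m1 + m2) (k1 + k2 + 1) (V1 \<union> V2)"
proof -
  obtain \<tau>1 where \<tau>1: "finite V1" "k1 \<le> card V1" "length \<tau>1 = m1" "tournament_collection V1 \<tau>1"
    "schuette_property k1 V1 \<tau>1"
    using 1 by (auto simp: schuette_set_def)
  obtain \<tau>2 where \<tau>2: "finite V2" "k2 \<le> card V2" "length \<tau>2 = m2" "tournament_collection V2 \<tau>2"
    "schuette_property k2 V2 \<tau>2"
    using 2 by (auto simp: schuette_set_def)
  \<comment> \<open>Each extended tournament needs some orientation inside the opposite side, and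
    any fixed one serves. As \<open>m1\<close> and \<open>m2\<close> are positive, the heads of the
    two lists provide them.\<close>
  obtain H1 H2 where H: "tournament H1" "pverts H1 = V1" "tournament H2" "pverts H2 = V2"
    using pos \<tau>1(3,4) \<tau>2(3,4) unfolding tournament_collection_def
    by (metis length_greater_0_conv list.set_sel(1))
  define \<tau> where "\<tau> = map (\<lambda>G. ordered_join G H2) \<tau>1 @ map (\<lambda>G. ordered_join G H1) \<tau>2"
  have "tournament_collection (V1 \<union> V2) \<tau>"
    using \<tau>1(4) \<tau>2(4) H disj
    by (auto simp: tournament_collection_def \<tau>_def intro!: tournament_ordered_join)
  moreover have "schuette_property (k1 + k2 + 1) (V1 \<union> V2) \<tau>"
    unfolding schuette_property_def
  proof safe
    fix U assume U: "U \<subseteq> V1 \<union> V2" "finite U" "card U = k1 + k2 + 1"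
    then have "U = (U \<inter> V1) \<union> (U \<inter> V2)"
      by auto
    then have "card U = card (U \<inter> V1) + card (U \<inter> V2)"
      using U(2) disj card_Un_disjoint[of "U \<inter> V1" "U \<inter> V2"] by force
    \<comment> \<open>Pigeonhole: if both bounds failed, \<open>U\<close> would have at least
      \<open>k1 + k2 + 2\<close> elements. This is where the join gains one over
      \<open>k1 + k2\<close>.\<close>
    then consider "card (U \<inter> V1) \<le> k1" | "card (U \<inter> V2) \<le> k2"
      using U(3) by linarith
    then show "\<exists>T\<in>set \<tau>. \<exists>u\<in>V1 \<union> V2. dominates T u U"
    proof cases
      case 1
      then show ?thesis
        using ordered_join_dominates[OF \<tau>1(5,1,2,4), of U H2] U(1) H(4)
        unfolding \<tau>_def by auto
    next
      case 2
      then show ?thesis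
        using ordered_join_dominates[OF \<tau>2(5,1,2,4), of U H1] U(1) H(2)
        unfolding \<tau>_def by (auto simp: Un_commute)
    qed
  qed
  moreover have "k1 + k2 + 1 \<le> card (V1 \<union> V2)"
    using schuette_set_card_gt[OF 1] schuette_set_card_gt[OF 2] \<tau>1(1) \<tau>2(1) disj
    by (simp add: card_Un_disjoint)
  moreover have "length \<tau> = m1 + m2"
    using \<tau>1(3) \<tau>2(3) by (simp add: \<tau>_def)
  ultimately show ?thesis
    using \<tau>1(1) \<tau>2(1) unfolding schuette_set_def by blast
qed

section \<open>Erdos's theorem by counting orientations\<close>

text \<open>Independence in counting form: for a random \<open>R \<subseteq> E\<close> the events
  \<open>R \<inter> A v = D v\<close> live on disjoint blocks and have probability 2^-k each, so all
  of them fail with probability (1 - 2^-k)^(card W). Denominators are cleared to stay in the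
  naturals. The induction splits one block off \<open>E\<close>.\<close>

lemma card_avoiding_subsets_le:
  assumes "finite W" "finite E" "\<And>v. v \<in> W \<Longrightarrow> A v \<subseteq> E" "\<And>v. v \<in> W \<Longrightarrow> card (A v) = k"
    and "disjoint_family_on A W" "\<And>v. v \<in> W \<Longrightarrow> D v \<subseteq> A v"
  shows "card {R \<in> Pow E. \<forall>v\<in>W. R \<inter> A v \<noteq> D v} * (2 ^ k) ^ card W
    \<le> 2 ^ card E * (2 ^ k - 1) ^ card W"
  using assms
proof (induction W arbitrary: E rule: finite_induct)
  case empty
  then show ?case by (simp add: card_Pow flip: Pow_def)
next
  case (insert w W)
  let ?E = "E - A w"
  let ?S = "{R \<in> Pow ?E. \<forall>v\<in>W. R \<inter> A v \<noteq> D v}"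
  let ?X = "Pow (A w) - {D w}"
  have fin: "finite (A w)" "finite ?E" "finite ?S" "finite ?X"
    using insert.prems(1,2) by (auto intro: finite_subset)
  have disj: "A w \<inter> A v = {}" if "v \<in> W" for v
    using insert.prems(4) that insert.hyps(2) by (auto simp: disjoint_family_on_def)
  have IH: "card ?S * (2 ^ k) ^ card W \<le> 2 ^ card ?E * (2 ^ k - 1) ^ card W"
  proof (rule insert.IH)
    show "A v \<subseteq> ?E" if "v \<in> W" for v
      using insert.prems(2) disj[OF that] that by auto
    show "disjoint_family_on A W"
      using insert.prems(4) by (auto simp: disjoint_family_on_def)
  qed (use fin insert.prems in auto)
  \<comment> \<open>\<open>R\<close> is recovered from its trace on \<open>A w\<close>, which
    differs from \<open>D w\<close>, and from the rest of \<open>R\<close>, whose traces on the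
    other blocks are unchanged by disjointness.\<close>
  have "{R \<in> Pow E. \<forall>v\<in>insert w W. R \<inter> A v \<noteq> D v} \<subseteq> (\<lambda>(X, Y). X \<union> Y) ` (?X \<times> ?S)"
  proof
    fix R assume R: "R \<in> {R \<in> Pow E. \<forall>v\<in>insert w W. R \<inter> A v \<noteq> D v}"
    have "(R - A w) \<inter> A v = R \<inter> A v" if "v \<in> W" for v
      using disj[OF that] by auto
    then have "(R \<inter> A w, R - A w) \<in> ?X \<times> ?S"
      using R by auto
    then show "R \<in> (\<lambda>(X, Y). X \<union> Y) ` (?X \<times> ?S)"
      by (rule rev_image_eqI) auto
  qed
  then have "card {R \<in> Pow E. \<forall>v\<in>insert w W. R \<inter> A v \<noteq> D v} \<le> card (?X \<times> ?S)"
    using fin by (meson finite_SigmaI card_image_le card_mono finite_imageI le_trans)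
  \<comment> \<open>As \<open>D w \<subseteq> A w\<close>, exactly one of the 2^k possible traces is
    removed.\<close>
  also have "\<dots> = (2 ^ k - 1) * card ?S"
    using fin insert.prems(3,5) by (simp add: card_cartesian_product card_Pow)
  finally have "card {R \<in> Pow E. \<forall>v\<in>insert w W. R \<inter> A v \<noteq> D v} * (2 ^ k) ^ card (insert w W)
      \<le> (2 ^ k - 1) * card ?S * (2 ^ k) ^ card (insert w W)"
    by simp
  also have "\<dots> = (2 ^ k - 1) * 2 ^ k * (card ?S * (2 ^ k) ^ card W)"
    using insert.hyps by simp
  also have "\<dots> \<le> (2 ^ k - 1) * 2 ^ k * (2 ^ card ?E * (2 ^ k - 1) ^ card W)"
    by (rule mult_left_mono[OF IH]) simp
  also have "\<dots> = 2 ^ (card ?E + k) * (2 ^ k - 1) ^ card (insert w W)"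
    using insert.hyps by (simp add: power_add)
  also have "card ?E + k = card E"
    using fin insert.prems(1,2,3)
    by (metis card_Diff_subset card_mono insertI1 le_add_diff_inverse2)
  finally show ?case .
qed

text \<open>The edges are the pairs \<open>i < j\<close>; the set \<open>R\<close> collects those directed upwards.\<close>

definition pair_orientation :: "nat \<Rightarrow> (nat \<times> nat) set \<Rightarrow> nat pair_pre_digraph" where
  "pair_orientation n R = \<lparr>pverts = {..<n},
     parcs = {(i, j). i < n \<and> j < n \<and> (i < j \<and> (i, j) \<in> R \<or> j < i \<and> (j, i) \<notin> R)}\<rparr>"

lemma pverts_pair_orientation [simp]: "pverts (pair_orientation n R) = {..<n}"
  by (simp add: pair_orientation_def)

lemma tournament_pair_orientation: "tournament (pair_orientation n R)"
  unfolding tournament_iff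
  by (auto simp: pair_orientation_def total_on_def)

text \<open>The edge between \<open>v\<close> and \<open>u\<close> is stored as
  \<open>(min v u, max v u)\<close> and points away from \<open>v\<close> if it lies in
  \<open>R\<close> exactly when \<open>v < u\<close>. Domination of \<open>U\<close> by
  \<open>v\<close> is thus one prescribed trace of \<open>R\<close> on the edges from
  \<open>v\<close> to \<open>U\<close>.\<close>

lemma dominates_pair_orientation:
  assumes "U \<subseteq> {..<n}" "v \<in> {..<n} - U"
    and "R \<inter> (\<lambda>u. (min v u, max v u)) ` U = {(v, u) | u. u \<in> U \<and> v < u}"
  shows "dominates (pair_orientation n R) v U"
  unfolding dominates_def
proof
  fix u assume u: "u \<in> U"
  with assms(1,2) have n: "u < n" "v < n" "u \<noteq> v"
    by auto
  have mem: "(min v u, max v u) \<in> R \<longleftrightarrow> (min v u, max v u) \<in> {(v, u) | u. u \<in> U \<and> v < u}"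
    using u by (subst assms(3)[symmetric]) blast
  show "(v, u) \<in> parcs (pair_orientation n R)"
  proof (cases "v < u")
    case True
    then show ?thesis
      using mem u n by (auto simp: pair_orientation_def)
  next
    case False
    then show ?thesis
      using mem u n by (auto simp: pair_orientation_def min_def max_def)
  qed
qed

text \<open>Each of the \<open>n - k\<close> vertices outside \<open>U\<close> has its own block of
  \<open>k\<close> edges to \<open>U\<close>. The blocks are disjoint, because an edge with one end
  in \<open>U\<close> and one outside determines the outer end.\<close>

lemma card_undominated_le:
  assumes "U \<subseteq> {..<n}" "card U = k" "E = {(i, j). i < j \<and> j < n}"
  shows "card {R \<in> Pow E. \<forall>v\<in>{..<n}. \<not> dominates (pair_orientation n R) v U} * (2 ^ k) ^ (n - k)
    \<le> 2 ^ card E * (2 ^ k - 1) ^ (n - k)"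
proof -
  define A where "A v = (\<lambda>u. (min v u, max v u)) ` U" for v
  define D where "D v = {(v, u) | u. u \<in> U \<and> v < u}" for v
  let ?W = "{..<n} - U"
  have "E \<subseteq> {..<n} \<times> {..<n}"
    unfolding assms(3) by auto
  then have fin: "finite E"
    by (rule finite_subset) simp
  have W: "card ?W = n - k"
    using assms(1,2) by (simp add: card_Diff_subset finite_subset)
  \<comment> \<open>Testing only vertices outside \<open>U\<close> can only enlarge the family
    counted, which suits an upper bound.\<close>
  have "{R \<in> Pow E. \<forall>v\<in>{..<n}. \<not> dominates (pair_orientation n R) v U}
      \<subseteq> {R \<in> Pow E. \<forall>v\<in>?W. R \<inter> A v \<noteq> D v}"
    using dominates_pair_orientation[OF assms(1)] unfolding A_def D_def by blast
  then have "card {R \<in> Pow E. \<forall>v\<in>{..<n}. \<not> dominates (pair_orientation n R) v U}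
      \<le> card {R \<in> Pow E. \<forall>v\<in>?W. R \<inter> A v \<noteq> D v}"
    using fin by (intro card_mono) auto
  moreover have "card {R \<in> Pow E. \<forall>v\<in>?W. R \<inter> A v \<noteq> D v} * (2 ^ k) ^ card ?W
    \<le> 2 ^ card E * (2 ^ k - 1) ^ card ?W"
  proof (rule card_avoiding_subsets_le)
    show "A v \<subseteq> E" if "v \<in> ?W" for v
    proof -
      have "min v u < max v u" if "u \<in> U" for u
        using that \<open>v \<in> ?W\<close> by (metis DiffD2 linorder_neq_iff max_def min_def order_less_imp_le leD)
      then show ?thesis
        using that assms(1) unfolding A_def assms(3) by auto
    qed
    show "card (A v) = k" for v
      unfolding A_def assms(2)[symmetric]
      by (rule card_image) (auto simp: inj_on_def min_def max_def split: if_splits)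
    show "disjoint_family_on A ?W"
      unfolding disjoint_family_on_def A_def by (auto simp: min_def max_def split: if_splits)
    show "D v \<subseteq> A v" for v
    proof
      fix e assume "e \<in> D v"
      then obtain u where "e = (v, u)" "u \<in> U" "v < u"
        by (auto simp: D_def)
      then have "e = (min v u, max v u)"
        by simp
      with \<open>u \<in> U\<close> show "e \<in> A v"
        by (simp add: A_def)
    qed
  qed (use fin in auto)
  ultimately show ?thesis
    unfolding W by (meson le_trans mult_le_mono1)
qed

text \<open>The binomial coefficient grows polynomially in \<open>n\<close>, while ((2^k - 1) /
  2^k)^(n - k) decays geometrically.\<close>

lemma exists_binomial_bound:
  "\<exists>n\<ge>k. (n choose k) * (2 ^ k - 1) ^ (n - k) < ((2 ^ k) ^ (n - k) :: nat)"
proof -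
  \<comment> \<open>A ratio slightly above 1 - 2^-k: it satisfies
    \<open>r * 2 ^ k = 2 ^ k - 1/2\<close> and stays strictly between 0 and 1 even for
    \<open>k = 0\<close>, where 1 - 2^-k vanishes.\<close>
  define r :: real where "r = 1 - 1 / 2 ^ (k + 1)"
  have "(2 :: real) ^ (k + 1) > 1"
    by (rule one_less_power) auto
  then have r: "0 < r" "r < 1"
    by (auto simp: r_def)
  then have "(\<lambda>n. real (n + k) ^ k * r ^ n) \<longlonglongrightarrow> 0"
    by real_asymp
  then have "eventually (\<lambda>n. real (n + k) ^ k * r ^ n < 1) sequentially"
    by (rule order_tendstoD) simp
  then obtain n where n: "real (n + k) ^ k * r ^ n < 1"
    by (auto simp: eventually_sequentially)
  have "(n + k) choose k \<le> (n + k) ^ k"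
    by (rule binomial_le_pow) simp
  then have "real ((n + k) choose k) \<le> real (n + k) ^ k"
    by (metis of_nat_le_iff of_nat_power)
  moreover have "(2 :: real) ^ k - 1 \<le> r * 2 ^ k"
    by (simp add: r_def field_simps)
  ultimately have "real ((n + k) choose k) * (2 ^ k - 1) ^ n \<le> real (n + k) ^ k * (r * 2 ^ k) ^ n"
    by (intro mult_mono power_mono) auto
  also have "\<dots> = real (n + k) ^ k * r ^ n * (2 ^ k) ^ n"
    by (simp add: power_mult_distrib)
  also have "\<dots> < 1 * (2 ^ k) ^ n"
    using n by (intro mult_strict_right_mono) auto
  finally have "real (((n + k) choose k) * (2 ^ k - 1) ^ n) < real ((2 ^ k) ^ n)"
    by (simp add: of_nat_diff)
  then have "((n + k) choose k) * (2 ^ k - 1) ^ n < (2 ^ k) ^ n"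
    by (simp only: of_nat_less_iff)
  then show ?thesis
    by (intro exI[of _ "n + k"]) auto
qed

text \<open>Union bound: the orientations failing for some \<open>k\<close>-set number fewer than
  all \<open>2 ^ card E\<close>, so some \<open>R\<close> fails for none.\<close>

theorem exists_schuette_tournament:
  "\<exists>n T. k \<le> n \<and> tournament T \<and> pverts T = {..<n} \<and> schuette_property k {..<n} [T]"
proof -
  obtain n where n: "k \<le> n" "(n choose k) * (2 ^ k - 1) ^ (n - k) < ((2 ^ k) ^ (n - k) :: nat)"
    using exists_binomial_bound by blast
  define E :: "(nat \<times> nat) set" where "E = {(i, j). i < j \<and> j < n}"
  define \<U> where "\<U> = {U. U \<subseteq> {..<n} \<and> card U = k}"
  define bad where
    "bad U = {R \<in> Pow E. \<forall>v\<in>{..<n}. \<not> dominates (pair_orientation n R) v U}" for U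
  have "E \<subseteq> {..<n} \<times> {..<n}"
    unfolding E_def by auto
  then have fin: "finite E"
    by (rule finite_subset) simp
  have \<U>: "finite \<U>" "card \<U> = n choose k"
    unfolding \<U>_def by (auto simp: n_subsets)
  have "card (\<Union>U\<in>\<U>. bad U) * (2 ^ k) ^ (n - k) \<le> (\<Sum>U\<in>\<U>. card (bad U)) * (2 ^ k) ^ (n - k)"
    using card_UN_le[OF \<U>(1)] by (rule mult_le_mono1)
  also have "\<dots> = (\<Sum>U\<in>\<U>. card (bad U) * (2 ^ k) ^ (n - k))"
    by (rule sum_distrib_right)
  also have "\<dots> \<le> (\<Sum>U\<in>\<U>. 2 ^ card E * (2 ^ k - 1) ^ (n - k))"
    unfolding bad_def \<U>_def by (intro sum_mono card_undominated_le) (auto simp: E_def)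
  also have "\<dots> = 2 ^ card E * ((n choose k) * (2 ^ k - 1) ^ (n - k))"
    by (simp add: \<U>)
  also have "\<dots> < 2 ^ card E * (2 ^ k) ^ (n - k)"
    using n(2) by (intro mult_strict_left_mono) auto
  finally have "card (\<Union>U\<in>\<U>. bad U) < card (Pow E)"
    by (simp add: card_Pow fin)
  moreover have "finite (\<Union>U\<in>\<U>. bad U)"
    using \<U>(1) fin by (auto simp: bad_def)
  ultimately have "\<not> Pow E \<subseteq> (\<Union>U\<in>\<U>. bad U)"
    using card_mono leD by blast
  then obtain R where R: "R \<in> Pow E" "\<forall>U\<in>\<U>. R \<notin> bad U"
    by blast
  have "schuette_property k {..<n} [pair_orientation n R]"
    using R unfolding schuette_property_def bad_def \<U>_def by auto
  then show ?thesis
    using n(1) tournament_pair_orientation by (metis pverts_pair_orientation)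
qed

section \<open>Attainment of the minimum and the two inequalities\<close>

text \<open>Copies of a single tournament with the property suffice; \<open>m > 0\<close> makes it
  occur in the list.\<close>

lemma exists_schuette_set:
  assumes "m > 0"
  shows "\<exists>V :: nat set. schuette_set m k V"
proof -
  obtain n T where T: "k \<le> n" "tournament T" "pverts T = {..<n}" "schuette_property k {..<n} [T]"
    using exists_schuette_tournament by blast
  then have "tournament_collection {..<n} (replicate m T)"
    "schuette_property k {..<n} (replicate m T)"
    using assms by (auto simp: tournament_collection_def schuette_property_def)
  then have "schuette_set m k {..<n}"
    unfolding schuette_set_def using T(1) by (metis finite_lessThan card_lessThan length_replicate)
  then show ?thesis ..
qed

text \<open>Existence makes the \<open>LEAST\<close> an attained minimum, so optimal vertex sets can
  be chosen.\<close>

lemma schuette_number_witness: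
  assumes "m > 0"
  obtains V :: "nat set" where "card V = schuette_number m k" "schuette_set m k V"
proof -
  have "\<exists>n. \<exists>V :: nat set. card V = n \<and> schuette_set m k V"
    using exists_schuette_set[OF assms] by blast
  then have "\<exists>V :: nat set. card V = schuette_number m k \<and> schuette_set m k V"
    unfolding schuette_number_eq by (rule LeastI_ex)
  then show thesis
    using that by blast
qed

lemma schuette_number_add_le:
  assumes "m1 > 0" "m2 > 0"
  shows "schuette_number (m1 + m2) (k1 + k2 + 1) \<le> schuette_number m1 k1 + schuette_number m2 k2"
proof -
  obtain V1 :: "nat set" where V1: "card V1 = schuette_number m1 k1" "schuette_set m1 k1 V1"
    using schuette_number_witness[OF assms(1)] .
  obtain V2 :: "nat set" where V2: "card V2 = schuette_number m2 k2" "schuette_set m2 k2 V2"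
    using schuette_number_witness[OF assms(2)] .
  \<comment> \<open>The two optimal sets of naturals may overlap; tagging by \<open>Inl\<close> and
    \<open>Inr\<close> makes them disjoint.\<close>
  have "schuette_set (m1 + m2) (k1 + k2 + 1) ((Inl ` V1 :: (nat + nat) set) \<union> Inr ` V2)"
    by (intro schuette_set_Un schuette_set_image V1(2) V2(2) assms) auto
  then have "schuette_number (m1 + m2) (k1 + k2 + 1) \<le> card ((Inl ` V1 :: (nat + nat) set) \<union> Inr ` V2)"
    by (rule schuette_number_le)
  also have "\<dots> \<le> card (Inl ` V1 :: (nat + nat) set) + card (Inr ` V2 :: (nat + nat) set)"
    by (rule card_Un_le)
  also have "\<dots> = schuette_number m1 k1 + schuette_number m2 k2"
    using V1(1) V2(1) by (simp add: card_image)
  finally show ?thesis .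
qed

text \<open>The join is additive in \<open>k + 1\<close>: (k1 + 1) + (k2 + 1) = (k1 + k2 + 1) + 1.
  Joining single tournaments with parameters \<open>ks\<close> therefore adds up the successors, and
  one is subtracted at the end.\<close>

lemma schuette_number_le_sum_list:
  assumes "ks \<noteq> []"
  shows "schuette_number (length ks) (sum_list (map Suc ks) - 1)
    \<le> sum_list (map single_schuette_number ks)"
  using assms
proof (induction ks rule: list_nonempty_induct)
  case (single k)
  then show ?case by simp
next
  case (cons k ks)
  \<comment> \<open>Positivity keeps the truncated subtraction of 1 exact.\<close>
  then have "sum_list (map Suc ks) > 0"
    by (cases ks) auto
  then have "k + (sum_list (map Suc ks) - 1) + 1 = sum_list (map Suc (k # ks)) - 1"
    by simp
  then show ?case
    using cons schuette_number_add_le[of 1 "length ks" k "sum_list (map Suc ks) - 1"] by simp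
qed

theorem theorem2p7:
  shows "(\<forall>m m1 m2 k k1 k2 :: nat.
            m > 0 \<longrightarrow> m1 > 0 \<longrightarrow> m2 > 0 \<longrightarrow> m1 + m2 = m \<longrightarrow> int k1 + int k2 = int k - 1 \<longrightarrow>
            schuette_number m k \<le> schuette_number m1 k1 + schuette_number m2 k2)
       \<and> (\<forall>m k a b :: nat.
            m > 0 \<longrightarrow> a \<ge> 1 \<longrightarrow> 1 \<le> b \<longrightarrow> b \<le> m \<longrightarrow> k + 1 = a * m + b \<longrightarrow>
            schuette_number m k
              \<le> b * single_schuette_number a + (m - b) * single_schuette_number (a - 1))"
proof (intro conjI allI impI)
  fix m m1 m2 k k1 k2 :: nat
  assume "m > 0" and *: "m1 > 0" "m2 > 0" "m1 + m2 = m" "int k1 + int k2 = int k - 1"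
  \<comment> \<open>The equation over the integers excludes \<open>k = 0\<close>.\<close>
  from *(4) have "k = k1 + k2 + 1"
    by linarith
  with *(1-3) show "schuette_number m k \<le> schuette_number m1 k1 + schuette_number m2 k2"
    using schuette_number_add_le by blast
next
  fix m k a b :: nat
  assume *: "m > 0" "a \<ge> 1" "1 \<le> b" "b \<le> m" "k + 1 = a * m + b"
  \<comment> \<open>The total \<open>k + 1 = a * m + b\<close> is split into \<open>m\<close> nearly
    equal successors: \<open>b\<close> of them equal to \<open>a + 1\<close> and
    \<open>m - b\<close> equal to \<open>a\<close>.\<close>
  define ks where "ks = replicate b a @ replicate (m - b) (a - 1)"
  have len: "ks \<noteq> []" "length ks = m"
    using * by (auto simp: ks_def)
  \<comment> \<open>Here \<open>a \<ge> 1\<close> gives \<open>Suc (a - 1) = a\<close>.\<close>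
  have "sum_list (map Suc ks) = b * Suc a + (m - b) * a"
    using *(2) by (simp add: ks_def sum_list_replicate)
  also have "\<dots> = (b + (m - b)) * a + b"
    by (simp only: add_mult_distrib mult_Suc_right)
  also have "\<dots> = k + 1"
    using *(4,5) by (simp add: mult.commute)
  finally show "schuette_number m k
      \<le> b * single_schuette_number a + (m - b) * single_schuette_number (a - 1)"
    using schuette_number_le_sum_list[OF len(1)] len(2)
    by (simp add: ks_def sum_list_replicate)
qed

end
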